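(* Let $\pi=(d_1,\dots,d_n)$ be the degree sequence of a tree with $d_1\ge d_2\ge\cdots\ge d_k\ge 2$ and $d_{k+1}=\cdots=d_n=1$, where $k\ge 3$. If $C(z_1,\dots,z_k)$ is a minimum optimal caterpillar in $\mathcal{C}_\pi$ (i.e. it minimizes $\varphi$ over $\mathcal{C}_\pi$) with $z_1\ge z_k$, then there exists an integer $t$ with $1\le t\le k-1$ such that $$z_1\ge z_2\ge\cdots\ge z_{t-1}>z_t=d_k-2\quad\text{and}\quad z_t\le z_{t+1}\le\cdots\le z_k.$$
   Context: A subtree of a tree is a nonempty connected subgraph; $\varphi(T)$ is the number of nonempty subtrees of $T$. A caterpillar is a tree containing a path such that every vertex not on the path is adjacent to a vertex on the path; $\mathcal{C}_\pi$ is the set of caterpillars with degree sequence $\pi$. For a permutation $(z_1,\dots,z_k)$ of $(d_1-2,\dots,d_k-2)$, $C(z_1,\dots,z_k)$ is the caterpillar obtained from a path $v_0v_1\cdots v_kv_{k+1}$ by attaching $z_j$ new pendant vertices to $v_j$ for $j=1,\dots,k$; every member of $\mathcal{C}_\pi$ is of this form. *)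

theory Defs
  imports "HOL-Library.Multiset"
begin

type_synonym 'a graph = "'a set \<times> 'a set set"

abbreviation verts :: "'a graph \<Rightarrow> 'a set" where "verts G \<equiv> fst G"
abbreviation edges :: "'a graph \<Rightarrow> 'a set set" where "edges G \<equiv> snd G"

definition simple_graph :: "'a graph \<Rightarrow> bool" where
  "simple_graph G \<longleftrightarrow> finite (verts G) \<and> (\<forall>e\<in>edges G. e \<subseteq> verts G \<and> card e = 2)"

definition connected_graph :: "'a graph \<Rightarrow> bool" where
  "connected_graph G \<longleftrightarrow>
     verts G \<noteq> {} \<and>
     (\<forall>u\<in>verts G. \<forall>v\<in>verts G. (u, v) \<in> {(x, y). {x, y} \<in> edges G}\<^sup>*)"

definition is_path :: "'a graph \<Rightarrow> 'a list \<Rightarrow> bool" where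
  "is_path G p \<longleftrightarrow>
     p \<noteq> [] \<and> distinct p \<and> set p \<subseteq> verts G \<and>
     (\<forall>i. Suc i < length p \<longrightarrow> {p ! i, p ! Suc i} \<in> edges G)"

definition is_cycle :: "'a graph \<Rightarrow> 'a list \<Rightarrow> bool" where
  "is_cycle G p \<longleftrightarrow> is_path G p \<and> length p \<ge> 3 \<and> {last p, hd p} \<in> edges G"

definition is_tree :: "'a graph \<Rightarrow> bool" where
  "is_tree G \<longleftrightarrow> simple_graph G \<and> connected_graph G \<and> (\<nexists>p. is_cycle G p)"

definition subgraphs :: "'a graph \<Rightarrow> 'a graph set" where
  "subgraphs G = {H. simple_graph H \<and> verts H \<subseteq> verts G \<and> edges H \<subseteq> edges G}"

text \<open>The number of (nonempty) subtrees of a tree; nonemptiness is part of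
  \<open>connected_graph\<close>.\<close>
definition num_subtrees :: "'a graph \<Rightarrow> nat" (\<open>\<phi>\<close>) where
  "\<phi> T = card {H \<in> subgraphs T. connected_graph H}"

definition degree :: "'a graph \<Rightarrow> 'a \<Rightarrow> nat" where
  "degree G v = card {e \<in> edges G. v \<in> e}"

text \<open>The sequence \<open>d 1, \<dots>, d n\<close> lists the vertex degrees of \<open>G\<close>
  with multiplicity, in some order; values of \<open>d\<close> outside \<open>{1..n}\<close> are
  irrelevant.\<close>
definition has_degree_sequence :: "'a graph \<Rightarrow> nat \<Rightarrow> (nat \<Rightarrow> nat) \<Rightarrow> bool" where
  "has_degree_sequence G n d \<longleftrightarrow>
     image_mset (degree G) (mset_set (verts G)) = image_mset d (mset_set {1..n})"

definition is_caterpillar :: "'a graph \<Rightarrow> bool" where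
  "is_caterpillar G \<longleftrightarrow>
     is_tree G \<and>
     (\<exists>p. is_path G p \<and>
        (\<forall>v\<in>verts G. v \<notin> set p \<longrightarrow> (\<exists>u\<in>set p. {v, u} \<in> edges G)))"

definition caterpillars :: "nat \<Rightarrow> (nat \<Rightarrow> nat) \<Rightarrow> 'a graph set" where
  "caterpillars n d = {G. is_caterpillar G \<and> has_degree_sequence G n d}"

text \<open>Competitors have the same vertex type as \<open>G\<close>. For an infinite vertex
  type this loses nothing, since every finite graph then has an isomorphic copy on it.\<close>
definition minimum_optimal_caterpillar ::
  "nat \<Rightarrow> (nat \<Rightarrow> nat) \<Rightarrow> 'a graph \<Rightarrow> bool" where
  "minimum_optimal_caterpillar n d G \<longleftrightarrow>
     G \<in> caterpillars n d \<and> (\<forall>H::'a graph\<in>caterpillars n d. \<phi> G \<le> \<phi> H)"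

text \<open>The caterpillar \<open>C(z 1, \<dots>, z k)\<close>: the path vertex \<open>v\<^sub>j\<close> is
  \<open>(j, 0)\<close> for \<open>0 \<le> j \<le> k + 1\<close>, and the pendant vertices attached to
  \<open>v\<^sub>j\<close> are \<open>(j, 1), \<dots>, (j, z j)\<close> for \<open>1 \<le> j \<le> k\<close>.\<close>
definition C_graph :: "nat \<Rightarrow> (nat \<Rightarrow> nat) \<Rightarrow> (nat \<times> nat) graph" where
  "C_graph k z =
     ({(j, 0) | j. j \<le> k + 1} \<union> {(j, i) | j i. j \<in> {1..k} \<and> i \<in> {1..z j}},
      {{(j, 0), (j + 1, 0)} | j. j \<le> k} \<union>
      {{(j, 0), (j, i)} | j i. j \<in> {1..k} \<and> i \<in> {1..z j}})"

end

theory Submission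
  imports Defs "HOL-Combinatorics.Permutations"
begin

text \<open>
  With \<open>x\<^sub>j = 2 ^ z\<^sub>j\<close>, a subtree meeting the spine \<open>v\<^sub>0 \<dots> v\<^sub>k\<^sub>+\<^sub>1\<close> is a spine interval together
  with any set of pendants attached to it, so minimizing the number of subtrees means minimizing
  the sum over all intervals of the products of the \<open>x\<^sub>j\<close>. Exchanging \<open>z\<^sub>l\<close> and \<open>z\<^sub>l\<^sub>+\<^sub>1\<close> changes this
  sum by \<open>(x\<^sub>l\<^sub>+\<^sub>1 - x\<^sub>l) (L\<^sub>l - R\<^sub>l\<^sub>+\<^sub>1)\<close>, where \<open>L\<^sub>l\<close> sums the products over the (possibly empty) intervals
  ending just before \<open>v\<^sub>l\<close> and \<open>R\<^sub>l\<^sub>+\<^sub>1\<close> over those starting just after \<open>v\<^sub>l\<^sub>+\<^sub>1\<close>. Since \<open>L\<close> is strictly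
  increasing and \<open>R\<close> strictly decreasing, an optimal \<open>z\<close> cannot ascend and later descend; and
  \<open>L\<^sub>k\<^sub>-\<^sub>1 > 2 = R\<^sub>k\<close> excludes a descent in the last step.
\<close>

section \<open>Connected graphs and cycles\<close>

text \<open>If no edge left \<open>X\<close>, everything reachable from \<open>u\<close> would stay
  in \<open>X\<close>. Below, a cut crossed by a single edge of the caterpillar forces that edge
  into every subtree with vertices on both sides.\<close>

lemma connected_graph_cut:
  assumes "connected_graph H" "u \<in> verts H" "v \<in> verts H" "u \<in> X" "v \<notin> X"
  shows "\<exists>x y. {x, y} \<in> edges H \<and> x \<in> X \<and> y \<notin> X"
proof -
  have "(u, v) \<in> {(x, y). {x, y} \<in> edges H}\<^sup>*"
    using assms by (auto simp: connected_graph_def)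
  then have "v \<in> X \<or> (\<exists>x y. {x, y} \<in> edges H \<and> x \<in> X \<and> y \<notin> X)"
    by (induction rule: rtrancl_induct) (use assms in auto)
  then show ?thesis using assms by blast
qed

lemma connected_graph_rootI:
  assumes "r \<in> verts H"
    and "\<And>v. v \<in> verts H \<Longrightarrow> (r, v) \<in> {(x, y). {x, y} \<in> edges H}\<^sup>*"
  shows "connected_graph H"
proof -
  have "sym {(x, y). {x, y} \<in> edges H}"
    by (auto simp: sym_def insert_commute)
  then have "sym ({(x, y). {x, y} \<in> edges H}\<^sup>*)"
    by (rule sym_rtrancl)
  then show ?thesis
    using assms unfolding connected_graph_def by (blast intro: rtrancl_trans dest: symD)
qed

lemma cycle_two_neighbours:
  assumes "is_cycle G p" "v \<in> set p"
  obtains x y where "x \<in> set p" "y \<in> set p" "x \<noteq> y" "{v, x} \<in> edges G" "{v, y} \<in> edges G"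
proof -
  define n where "n = length p"
  have n: "n \<ge> 3" and dist: "distinct p"
    and e: "\<And>i. Suc i < n \<Longrightarrow> {p ! i, p ! Suc i} \<in> edges G"
    and cl: "{p ! (n - 1), p ! 0} \<in> edges G"
    using assms by (auto simp: is_cycle_def is_path_def n_def last_conv_nth hd_conv_nth)
  obtain i where i: "i < n" "v = p ! i"
    using assms by (auto simp: in_set_conv_nth n_def)
  \<comment> \<open>Cyclic predecessor and successor of position \<open>i\<close>; they differ
    because \<open>n \<ge> 3\<close>, and wrapping around uses the closing edge.\<close>
  define a where "a = (if i = 0 then n - 1 else i - 1)"
  define b where "b = (if i = n - 1 then 0 else Suc i)"
  have ab: "a < n" "b < n" "a \<noteq> b"
    using n i by (auto simp: a_def b_def split: if_splits)
  have "{v, p ! a} \<in> edges G"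
    using e[of "i - 1"] cl i by (auto simp: a_def insert_commute)
  moreover have "{v, p ! b} \<in> edges G"
    using e[of i] cl i by (auto simp: b_def insert_commute)
  moreover have "p ! a \<noteq> p ! b"
    using ab dist by (simp add: n_def nth_eq_iff_index_eq)
  ultimately show thesis
    using ab by (intro that[of "p ! a" "p ! b"]) (auto simp: n_def)
qed

text \<open>A vertex of maximal rank on a cycle would have two distinct neighbours of no larger
  rank.\<close>

lemma no_cycle_rank:
  fixes rank :: "'a \<Rightarrow> nat"
  assumes "\<And>v x y. {v, x} \<in> edges G \<Longrightarrow> {v, y} \<in> edges G \<Longrightarrow>
      rank x \<le> rank v \<Longrightarrow> rank y \<le> rank v \<Longrightarrow> x = y"
  shows "\<not> is_cycle G p"
proof
  assume c: "is_cycle G p"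
  then have "set p \<noteq> {}" by (auto simp: is_cycle_def is_path_def)
  then obtain v where v: "v \<in> set p" "\<And>w. w \<in> set p \<Longrightarrow> rank w \<le> rank v"
    using Max_in[of "rank ` set p"] Max_ge[of "rank ` set p"]
    by (smt (verit) finite_imageI finite_set image_iff image_is_empty)
  from cycle_two_neighbours[OF c v(1)] assms v(2) show False by metis
qed

section \<open>The caterpillar with spine of length m\<close>

text \<open>The two end vertices of \<open>C(z\<^sub>1, \<dots>, z\<^sub>k)\<close> are treated as spine vertices
  without pendants, so that all spine vertices contribute uniformly to the number of subtrees.\<close>

definition caterpillar :: "nat \<Rightarrow> (nat \<Rightarrow> nat) \<Rightarrow> (nat \<times> nat) graph" where
  "caterpillar m z =
     ({(j, i). j \<le> m \<and> i \<le> z j},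
      {{(j, 0), (Suc j, 0)} | j. j < m} \<union> {{(j, 0), (j, i)} | j i. j \<le> m \<and> 1 \<le> i \<and> i \<le> z j})"

text \<open>\<open>C_graph\<close> reads \<open>z\<close> only on \<open>{1..k}\<close>, whereas
  \<open>caterpillar\<close> reads it at every spine position; the default 0 leaves the two ends
  without pendants.\<close>

lemma C_graph_eq_caterpillar:
  "C_graph k z = caterpillar (Suc k) (\<lambda>j. if 1 \<le> j \<and> j \<le> k then z j else 0)"
proof -
  have "verts (C_graph k z) = {(j, i). j \<le> Suc k \<and> i \<le> (if 1 \<le> j \<and> j \<le> k then z j else 0)}"
    by (auto simp: C_graph_def split: if_splits)
  moreover have "{{(j, 0), (j + 1, 0::nat)} | j. j \<le> k} = {{(j, 0), (Suc j, 0)} | j. j < Suc k}"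
    by (auto simp: less_Suc_eq_le)
  moreover have "j \<in> {1..k} \<and> i \<in> {1..z j} \<longleftrightarrow>
      j \<le> Suc k \<and> 1 \<le> i \<and> i \<le> (if 1 \<le> j \<and> j \<le> k then z j else 0)" for j i
    by auto
  ultimately show ?thesis
    unfolding prod_eq_iff by (simp only: C_graph_def caterpillar_def fst_conv snd_conv)
qed

lemma verts_caterpillar: "(j, i) \<in> verts (caterpillar m z) \<longleftrightarrow> j \<le> m \<and> i \<le> z j"
  by (simp add: caterpillar_def)

lemma edges_caterpillar:
  "{(a, b), (c, e)} \<in> edges (caterpillar m z) \<longleftrightarrow>
     b = 0 \<and> e = 0 \<and> (c = Suc a \<and> a < m \<or> a = Suc c \<and> c < m) \<or>
     a = c \<and> a \<le> m \<and> (b = 0 \<and> 1 \<le> e \<and> e \<le> z a \<or> e = 0 \<and> 1 \<le> b \<and> b \<le> z a)"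
  by (auto simp: caterpillar_def doubleton_eq_iff)

lemma edge_caterpillar_cases:
  assumes "e \<in> edges (caterpillar m z)"
  obtains (spine) j where "j < m" "e = {(j, 0), (Suc j, 0)}"
  | (pendant) j i where "j \<le> m" "i < z j" "e = {(j, 0), (j, Suc i)}"
proof -
  consider j where "j < m" "e = {(j, 0), (Suc j, 0)}"
    | j i where "j \<le> m" "1 \<le> i" "i \<le> z j" "e = {(j, 0), (j, i)}"
    using assms by (auto simp: caterpillar_def)
  then show thesis
  proof cases
    case (2 j i)
    then show thesis using pendant[of j "i - 1"] by simp
  qed (rule spine)
qed

lemma finite_verts_caterpillar: "finite (verts (caterpillar m z))"
proof -
  have "verts (caterpillar m z) = (SIGMA j:{..m}. {..z j})"
    by (auto simp: caterpillar_def)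
  then show ?thesis by simp
qed

lemma simple_graph_caterpillar: "simple_graph (caterpillar m z)"
  unfolding simple_graph_def
proof (intro conjI ballI finite_verts_caterpillar)
  fix e assume "e \<in> edges (caterpillar m z)"
  then show "e \<subseteq> verts (caterpillar m z)" "card e = 2"
    by (cases rule: edge_caterpillar_cases; auto simp: verts_caterpillar)+
qed

text \<open>Apart from \<open>z j\<close>, the position \<open>j\<close> matters only through being
  an end or not, so rearranging inner pendant numbers merely rearranges degrees. With
  \<open>0 < m\<close> the two ends are distinct and each has one spine neighbour.\<close>

lemma degree_caterpillar:
  assumes "0 < m" "(j, i) \<in> verts (caterpillar m z)"
  shows "degree (caterpillar m z) (j, i) =
    (if 0 < i then 1 else z j + (if j = 0 \<or> j = m then 1 else 2))"
proof -
  let ?E = "edges (caterpillar m z)"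
  have ji: "j \<le> m" "i \<le> z j" using assms by (auto simp: verts_caterpillar)
  show ?thesis
  proof (cases "0 < i")
    case True
    have "{e \<in> ?E. (j, i) \<in> e} = {{(j, 0), (j, i)}}"
      using True ji by (auto simp: caterpillar_def)
    then show ?thesis using True by (simp add: degree_def)
  next
    case False
    \<comment> \<open>Pendant edges at \<open>j\<close>, followed by the spine edges at
      \<open>j\<close>, indexed by their left end.\<close>
    define A where "A = (\<lambda>b. {(j, 0), (j, b)}) ` {1..z j}"
    define B where "B = (\<lambda>a. {(a, 0), (Suc a, 0::nat)}) ` {a. a < m \<and> (a = j \<or> Suc a = j)}"
    have "{e \<in> ?E. (j, i) \<in> e} = A \<union> B"
      using False ji by (auto simp: caterpillar_def A_def B_def)
    moreover have "card A = z j"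
      unfolding A_def by (subst card_image) (auto simp: inj_on_def doubleton_eq_iff)
    moreover have "card B = card {a. a < m \<and> (a = j \<or> Suc a = j)}"
      unfolding B_def by (subst card_image) (auto simp: inj_on_def doubleton_eq_iff)
    moreover have *: "{a. a < m \<and> (a = j \<or> Suc a = j)} =
        (if j < m then {j} else {}) \<union> (if 0 < j then {j - 1} else {})"
      using ji by auto
    have "card {a. a < m \<and> (a = j \<or> Suc a = j)} = (if j = 0 \<or> j = m then 1 else 2)"
      unfolding * using ji assms(1) by auto
    moreover have "{(j, 0), (j, b)} \<noteq> {(a, 0), (Suc a, 0)}" for a b
      by (simp add: doubleton_eq_iff)
    then have "A \<inter> B = {}"
      unfolding A_def B_def by blast
    moreover have "finite A" "finite B"
      by (auto simp: A_def B_def)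
    ultimately show ?thesis
      using False by (simp add: degree_def card_Un_disjoint)
  qed
qed

lemma no_cycle_caterpillar: "\<not> is_cycle (caterpillar m z) p"
\<comment> \<open>Spine vertices are ranked by position, all pendants above them. Then only its
  predecessor (for a spine vertex) or its spine vertex (for a pendant) is a neighbour of no larger
  rank.\<close>
proof (rule no_cycle_rank[where rank = "\<lambda>(j, i). if i = 0 then j else Suc m"])
  fix v x y :: "nat \<times> nat"
  let ?r = "\<lambda>(j, i). if i = 0 then j else Suc m"
  assume "{v, x} \<in> edges (caterpillar m z)" "{v, y} \<in> edges (caterpillar m z)"
    "?r x \<le> ?r v" "?r y \<le> ?r v"
  then show "x = y"
    by (cases v; cases x; cases y) (auto simp: edges_caterpillar split: if_splits)
qed

section \<open>Subtrees of a caterpillar\<close>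

definition induced :: "'a graph \<Rightarrow> 'a set \<Rightarrow> 'a graph" where
  "induced G W = (W, {e \<in> edges G. e \<subseteq> W})"

definition pendants :: "(nat \<Rightarrow> nat) \<Rightarrow> nat set \<Rightarrow> (nat \<times> nat) set" where
  "pendants z I = (SIGMA j:I. {1..z j})"

definition segment :: "nat \<Rightarrow> nat \<Rightarrow> (nat \<times> nat) set \<Rightarrow> (nat \<times> nat) set" where
  "segment i j S = {i..j} \<times> {0} \<union> S"

text \<open>From the left end one walks along the spine and takes one more step to reach a
  pendant.\<close>

lemma connected_induced_segment:
  assumes "i \<le> j" "j \<le> m" "S \<subseteq> pendants z {i..j}"
  shows "connected_graph (induced (caterpillar m z) (segment i j S))"
    (is "connected_graph ?H")
proof (rule connected_graph_rootI)
  show "(i, 0) \<in> verts ?H"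
    using assms by (auto simp: induced_def segment_def)
  fix v assume v: "v \<in> verts ?H"
  let ?R = "{(x, y). {x, y} \<in> edges ?H}"
  have spine: "((i, 0), (l, 0)) \<in> ?R\<^sup>*" if "i \<le> l" "l \<le> j" for l
    using that
  proof (induction l rule: dec_induct)
    case (step l)
    have "((l, 0), (Suc l, 0)) \<in> ?R"
      using step.hyps step.prems assms by (auto simp: induced_def segment_def edges_caterpillar)
    then show ?case using step by (meson Suc_leD rtrancl.rtrancl_into_rtrancl)
  qed auto
  obtain a b where ab: "v = (a, b)" by fastforce
  show "((i, 0), v) \<in> ?R\<^sup>*"
  proof (cases "b = 0")
    case True
    then have "i \<le> a" "a \<le> j"
      using v ab assms by (auto simp: induced_def segment_def pendants_def)
    then show ?thesis using spine ab True by auto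
  next
    case False
    then have a: "i \<le> a" "a \<le> j" "b \<le> z a"
      using v ab assms by (auto simp: induced_def segment_def pendants_def)
    then have "((a, 0), v) \<in> ?R"
      using False v ab assms by (auto simp: induced_def segment_def edges_caterpillar)
    then show ?thesis using spine[of a] a by (meson rtrancl.rtrancl_into_rtrancl)
  qed
qed

lemma induced_in_subgraphs:
  assumes "simple_graph G" "W \<subseteq> verts G"
  shows "induced G W \<in> subgraphs G"
  using assms by (auto simp: subgraphs_def induced_def simple_graph_def finite_subset)

lemma segment_subset_verts:
  assumes "j \<le> m" "S \<subseteq> pendants z {i..j}"
  shows "segment i j S \<subseteq> verts (caterpillar m z)"
  using assms by (fastforce simp: segment_def caterpillar_def pendants_def)

text \<open>Connectedness forces into \<open>H\<close> all caterpillar edges between its vertices,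
  so \<open>H\<close> is determined by its vertex set. The spine positions form an interval; if
  there are none, a pendant cannot be joined to anything else.\<close>

lemma subtree_caterpillar_cases:
  assumes "H \<in> subgraphs (caterpillar m z)" "connected_graph H"
  shows "(\<exists>v \<in> pendants z {..m}. H = induced (caterpillar m z) {v}) \<or>
    (\<exists>i j S. i \<le> j \<and> j \<le> m \<and> S \<subseteq> pendants z {i..j} \<and>
       H = induced (caterpillar m z) (segment i j S))"
proof -
  let ?G = "caterpillar m z"
  have V: "verts H \<subseteq> verts ?G" and E: "edges H \<subseteq> edges ?G"
    and eV: "\<And>e. e \<in> edges H \<Longrightarrow> e \<subseteq> verts H" and ne: "verts H \<noteq> {}"
    using assms by (auto simp: subgraphs_def simple_graph_def connected_graph_def)
  \<comment> \<open>Only one edge of the caterpillar crosses the cut between the positions up to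
    \<open>l\<close> and those beyond.\<close>
  have spine_edge: "{(l, 0), (Suc l, 0)} \<in> edges H"
    if *: "(a, b) \<in> verts H" "(c, e) \<in> verts H" "a \<le> l" "l < c" for a b c e l
  proof -
    have "\<exists>x y. {x, y} \<in> edges H \<and> x \<in> {p. fst p \<le> l} \<and> y \<notin> {p. fst p \<le> l}"
      by (rule connected_graph_cut[OF assms(2) *(1,2)]) (use * in auto)
    then obtain x y where "{x, y} \<in> edges H" "fst x \<le> l" "\<not> fst y \<le> l"
      by blast
    moreover from this have "x = (l, 0) \<and> y = (Suc l, 0)"
      using E by (cases x; cases y) (auto simp: edges_caterpillar dest!: subsetD)
    ultimately show ?thesis by simp
  qed
  \<comment> \<open>Here the cut isolates a pendant, whose only edge goes to its spine
    vertex.\<close>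
  have pendant_edge: "{(a, 0), (a, b)} \<in> edges H"
    if *: "(a, b) \<in> verts H" "v \<in> verts H" "v \<noteq> (a, b)" "b > 0" for a b v
  proof -
    have "\<exists>x y. {x, y} \<in> edges H \<and> x \<in> {(a, b)} \<and> y \<notin> {(a, b)}"
      by (rule connected_graph_cut[OF assms(2) *(1,2)]) (use * in auto)
    then obtain x y where "{x, y} \<in> edges H" "x = (a, b)" "y \<noteq> (a, b)"
      by blast
    moreover from this have "y = (a, 0)"
      using E * by (cases y) (auto simp: edges_caterpillar dest!: subsetD)
    ultimately show ?thesis by (simp add: insert_commute)
  qed
  have "e \<in> edges H" if "e \<in> edges ?G" "e \<subseteq> verts H" for e
    using that(1)
  proof (cases rule: edge_caterpillar_cases)
    case (spine j)
    then show ?thesis using \<open>e \<subseteq> verts H\<close> spine_edge[of j 0 "Suc j" 0 j] by auto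
  next
    case (pendant j i)
    then show ?thesis using \<open>e \<subseteq> verts H\<close> pendant_edge[of j "Suc i" "(j, 0)"] by auto
  qed
  then have "edges H = {e \<in> edges ?G. e \<subseteq> verts H}"
    using E eV by auto
  then have H: "H = induced ?G (verts H)"
    by (simp add: induced_def prod_eq_iff)
  define I where "I = {l. (l, 0) \<in> verts H}"
  show ?thesis
  proof (cases "I = {}")
    case True
    obtain a b where ab: "(a, b) \<in> verts H" using ne by auto
    then have "b > 0" using True by (auto simp: I_def intro: gr0I)
    then have "v = (a, b)" if "v \<in> verts H" for v
      using pendant_edge[OF ab that] eV[of "{(a, 0), (a, b)}"] True by (auto simp: I_def)
    then have "verts H = {(a, b)}" using ab by blast
    moreover have "(a, b) \<in> pendants z {..m}"
      using ab V \<open>b > 0\<close> by (auto simp: pendants_def caterpillar_def)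
    ultimately show ?thesis using H by metis
  next
    case False
    have "I \<subseteq> {..m}" using V by (auto simp: I_def caterpillar_def)
    then have fin: "finite I" using finite_subset by blast
    define i j where "i = Min I" and "j = Max I"
    have iI: "i \<in> I" and jI: "j \<in> I" and ij: "\<And>l. l \<in> I \<Longrightarrow> i \<le> l \<and> l \<le> j"
      using fin False by (auto simp: i_def j_def)
    \<comment> \<open>Every spine edge between the extreme positions is forced, so there is no
      gap.\<close>
    have I: "I = {i..j}"
    proof
      show "{i..j} \<subseteq> I"
      proof
        fix l assume l: "l \<in> {i..j}"
        show "l \<in> I"
        proof (cases "l = j")
          case False
          then have "{(l, 0), (Suc l, 0)} \<in> edges H"
            using spine_edge[of i 0 j 0 l] l iI jI by (auto simp: I_def)
          then show ?thesis using eV by (auto simp: I_def)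
        qed (use jI in simp)
      qed
    qed (use ij in auto)
    define S where "S = {v \<in> verts H. snd v > 0}"
    have "S \<subseteq> pendants z {i..j}"
    proof
      fix v assume "v \<in> S"
      then obtain a b where v: "v = (a, b)" "(a, b) \<in> verts H" "b > 0"
        by (cases v) (auto simp: S_def)
      then have "{(a, 0), (a, b)} \<in> edges H"
        using pendant_edge[of a b "(i, 0)"] iI by (auto simp: I_def)
      then have "a \<in> I" using eV by (auto simp: I_def)
      then show "v \<in> pendants z {i..j}"
        using v V I by (auto simp: pendants_def caterpillar_def)
    qed
    moreover have "verts H = segment i j S"
      using I by (auto simp: segment_def S_def I_def)
    moreover have "i \<le> j" "j \<le> m"
      using ij[OF iI] jI \<open>I \<subseteq> {..m}\<close> by auto
    ultimately show ?thesis using H by metis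
  qed
qed

lemma inj_induced: "inj (induced G)"
  by (auto simp: inj_def induced_def)

lemma subtrees_caterpillar:
  "{H \<in> subgraphs (caterpillar m z). connected_graph H} =
     induced (caterpillar m z) ` ((\<lambda>v. {v}) ` pendants z {..m} \<union>
       (\<lambda>((i, j), S). segment i j S) `
         (SIGMA (i, j):{(i, j). i \<le> j \<and> j \<le> m}. Pow (pendants z {i..j})))"
  (is "?L = ?R")
proof
  show "?L \<subseteq> ?R"
  proof
    fix H assume "H \<in> ?L"
    then consider (pendant) v where "v \<in> pendants z {..m}" "H = induced (caterpillar m z) {v}"
      | (segment) i j S where "i \<le> j" "j \<le> m" "S \<subseteq> pendants z {i..j}"
         "H = induced (caterpillar m z) (segment i j S)"
      using subtree_caterpillar_cases[of H m z] by blast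
    then show "H \<in> ?R"
    proof cases
      case segment
      then have "((i, j), S) \<in> (SIGMA (i, j):{(i, j). i \<le> j \<and> j \<le> m}. Pow (pendants z {i..j}))"
        by auto
      then show ?thesis using segment by force
    qed auto
  qed
  have "connected_graph (induced (caterpillar m z) {v})" for v
    by (auto simp: connected_graph_def induced_def)
  moreover have "pendants z {..m} \<subseteq> verts (caterpillar m z)"
    by (auto simp: pendants_def caterpillar_def)
  ultimately show "?R \<subseteq> ?L"
    by (auto intro!: induced_in_subgraphs simple_graph_caterpillar connected_induced_segment
        dest: segment_subset_verts)
qed

section \<open>Number of subtrees as an interval sum\<close>

definition interval_weight :: "nat \<Rightarrow> (nat \<Rightarrow> nat) \<Rightarrow> nat" where
  "interval_weight m x = (\<Sum>(i, j) \<in> {(i, j). i \<le> j \<and> j \<le> m}. \<Prod>l = i..j. x l)"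

lemma finite_intervals: "finite {(i, j). i \<le> j \<and> j \<le> (m::nat)}"
  by (rule finite_subset[of _ "{..m} \<times> {..m}"]) auto

lemma card_pendants: "finite I \<Longrightarrow> card (pendants z I) = (\<Sum>j\<in>I. z j)"
  by (simp add: pendants_def)

lemma finite_pendants: "finite I \<Longrightarrow> finite (pendants z I)"
  by (simp add: pendants_def)

text \<open>Lone pendants give the first sum. An interval combines with any subset of its pendants,
  and the number of these subsets is the product of the \<open>2 ^ z l\<close> over the
  interval.\<close>

lemma num_subtrees_caterpillar:
  "\<phi> (caterpillar m z) = (\<Sum>j\<le>m. z j) + interval_weight m (\<lambda>j. 2 ^ z j)"
proof -
  let ?D = "SIGMA (i, j):{(i, j). i \<le> j \<and> j \<le> m}. Pow (pendants z {i..j})"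
  let ?A = "(\<lambda>v. {v}) ` pendants z {..m}"
  let ?s = "\<lambda>((i, j), S). segment i j S"
  \<comment> \<open>Interval and pendant set can both be read off from \<open>segment i j S\<close>,
    which gives injectivity.\<close>
  have spine: "{l. (l, 0) \<in> segment i j S} = {i..j}" if "S \<subseteq> pendants z {i..j}" for i j S
    using that by (auto simp: segment_def pendants_def)
  have pend: "{v \<in> segment i j S. 0 < snd v} = S" if "S \<subseteq> pendants z {i..j}" for i j S
    using that by (auto simp: segment_def pendants_def)
  have inj: "inj_on ?s ?D"
  proof (rule inj_onI)
    fix u v assume uv: "u \<in> ?D" "v \<in> ?D" "?s u = ?s v"
    obtain i j S i' j' S' where eq: "u = ((i, j), S)" "v = ((i', j'), S')"
      by (metis surj_pair)
    have *: "i \<le> j" "i' \<le> j'" "S \<subseteq> pendants z {i..j}" "S' \<subseteq> pendants z {i'..j'}"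
      "segment i j S = segment i' j' S'"
      using uv eq by auto
    then have "{i..j} = {i'..j'}" "S = S'"
      using spine pend by metis+
    then show "u = v" using * eq by (simp add: Icc_eq_Icc)
  qed
  have "{v} \<noteq> segment i j S" if "v \<in> pendants z {..m}" "i \<le> j" for v i j S
  proof -
    have "(i, 0) \<in> segment i j S" "(i, 0) \<noteq> v"
      using that by (auto simp: segment_def pendants_def)
    then show ?thesis by blast
  qed
  then have disj: "?A \<inter> ?s ` ?D = {}"
    by fast
  have fin: "finite ?D"
    by (intro finite_SigmaI finite_intervals, clarify) (simp add: finite_pendants)
  have "\<phi> (caterpillar m z) = card (?A \<union> ?s ` ?D)"
    unfolding num_subtrees_def subtrees_caterpillar
    by (rule card_image, rule inj_on_subset[OF inj_induced subset_UNIV])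
  also have "\<dots> = card ?A + card (?s ` ?D)"
    using disj fin by (intro card_Un_disjoint) (auto simp: finite_pendants)
  also have "card ?A = (\<Sum>j\<le>m. z j)"
    by (subst card_image) (auto simp: card_pendants)
  also have "card (?s ` ?D) = card ?D"
    by (rule card_image[OF inj])
  also have "\<dots> = (\<Sum>(i, j) \<in> {(i, j). i \<le> j \<and> j \<le> m}. card (Pow (pendants z {i..j})))"
    by (subst card_SigmaI) (auto simp: finite_intervals finite_pendants intro!: sum.cong)
  also have "\<dots> = interval_weight m (\<lambda>j. 2 ^ z j)"
    by (simp add: interval_weight_def card_Pow finite_pendants card_pendants power_sum)
  finally show ?thesis .
qed

section \<open>Permuting the pendant numbers\<close>

lemma connected_caterpillar: "connected_graph (caterpillar m z)"
proof -
  \<comment> \<open>The whole caterpillar is the segment from \<open>0\<close> to \<open>m\<close>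
    with all pendants.\<close>
  have V: "segment 0 m (pendants z {0..m}) = verts (caterpillar m z)"
    by (auto simp: segment_def pendants_def caterpillar_def Suc_le_eq)
  have "induced (caterpillar m z) (segment 0 m (pendants z {0..m})) = caterpillar m z"
    using simple_graph_caterpillar[of m z] unfolding V
    by (auto simp: induced_def simple_graph_def prod_eq_iff)
  then show ?thesis
    using connected_induced_segment[of 0 m m "pendants z {0..m}" z] by simp
qed

lemma is_caterpillar_caterpillar: "is_caterpillar (caterpillar m z)"
proof -
  let ?p = "map (\<lambda>j. (j, 0::nat)) [0..<Suc m]"
  have "is_path (caterpillar m z) ?p"
    unfolding is_path_def
    by (auto simp: distinct_map inj_on_def caterpillar_def edges_caterpillar nth_append
        simp del: upt_Suc)
  moreover have "\<exists>u\<in>set ?p. {v, u} \<in> edges (caterpillar m z)"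
    if "v \<in> verts (caterpillar m z)" "v \<notin> set ?p" for v
  proof -
    obtain a b where v: "v = (a, b)" by fastforce
    then have "a \<le> m" "b \<le> z a" "b \<noteq> 0"
      using that by (auto simp: verts_caterpillar simp del: upt_Suc)
    then have "(a, 0) \<in> set ?p" "{v, (a, 0)} \<in> edges (caterpillar m z)"
      by (auto simp: v edges_caterpillar simp del: upt_Suc)
    then show ?thesis by blast
  qed
  ultimately show ?thesis
    unfolding is_caterpillar_def is_tree_def
    using simple_graph_caterpillar connected_caterpillar no_cycle_caterpillar by blast
qed

text \<open>\<open>\<pi>\<close> fixes both ends, so inner positions stay inner and the degree
  formula carries over.\<close>

lemma has_degree_sequence_caterpillar_permute:
  assumes "0 < m" "\<pi> permutes {0<..<m}" "has_degree_sequence (caterpillar m z) n d"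
  shows "has_degree_sequence (caterpillar m (z \<circ> \<pi>)) n d"
proof -
  let ?G = "caterpillar m z" and ?H = "caterpillar m (z \<circ> \<pi>)"
  \<comment> \<open>A degree-preserving bijection of the vertices; it need not preserve
    edges.\<close>
  define f where "f = (\<lambda>(j, i::nat). (\<pi> j, i))"
  have inv: "\<pi> (inv \<pi> j) = j" for j
    using assms(2) by (simp add: permutes_inverses)
  have "\<pi> permutes {..m}"
    using assms(2) by (rule permutes_subset) auto
  then have le: "\<pi> j \<le> m \<longleftrightarrow> j \<le> m" for j
    using permutes_in_image by fastforce
  have "inj f"
    using permutes_inj[OF assms(2)] by (auto simp: f_def inj_def)
  have "f ` verts ?H = verts ?G"
  proof
    show "f ` verts ?H \<subseteq> verts ?G"
      by (auto simp: f_def caterpillar_def le)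
    show "verts ?G \<subseteq> f ` verts ?H"
    proof
      fix v assume v: "v \<in> verts ?G"
      obtain j i where ji: "v = (j, i)" by fastforce
      have "(inv \<pi> j, i) \<in> verts ?H"
        using v ji le[of "inv \<pi> j"] by (simp add: verts_caterpillar inv)
      moreover have "v = f (inv \<pi> j, i)"
        using ji inv by (simp add: f_def)
      ultimately show "v \<in> f ` verts ?H" by blast
    qed
  qed
  then have G: "mset_set (verts ?G) = image_mset f (mset_set (verts ?H))"
    using image_mset_mset_set[of f "verts ?H"] \<open>inj f\<close> by (metis inj_on_subset subset_UNIV)
  have "degree ?H v = degree ?G (f v)" if "v \<in> verts ?H" for v
  proof -
    obtain j i where ji: "v = (j, i)" by fastforce
    have "f v \<in> verts ?G"
      using that \<open>f ` verts ?H = verts ?G\<close> by blast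
    moreover have "\<pi> j = 0 \<longleftrightarrow> j = 0" "\<pi> j = m \<longleftrightarrow> j = m"
      using inj_eq[OF permutes_inj[OF assms(2)], of j 0] inj_eq[OF permutes_inj[OF assms(2)], of j m]
        permutes_not_in[OF assms(2), of 0] permutes_not_in[OF assms(2), of m] by simp_all
    ultimately show ?thesis
      using that assms(1) by (simp add: ji f_def degree_caterpillar)
  qed
  then have "image_mset (degree ?H) (mset_set (verts ?H)) =
      image_mset (degree ?G) (mset_set (verts ?G))"
    unfolding G multiset.map_comp comp_def
    using finite_verts_caterpillar by (intro image_mset_cong) simp
  then show ?thesis using assms(3) by (simp add: has_degree_sequence_def)
qed

text \<open>The count of lone pendants ignores order; only the interval sum can change.\<close>

lemma num_subtrees_caterpillar_permute:
  assumes "\<pi> permutes {..m}"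
  shows "\<phi> (caterpillar m (z \<circ> \<pi>)) =
    (\<Sum>j\<le>m. z j) + interval_weight m ((\<lambda>j. 2 ^ z j) \<circ> \<pi>)"
  using sum.permute[OF assms, of z] by (simp add: num_subtrees_caterpillar comp_def)

section \<open>Adjacent transpositions\<close>

text \<open>The quantity \<open>L\<close> of the outline; \<open>i = l\<close> contributes the empty
  interval.\<close>

definition left_weight :: "(nat \<Rightarrow> nat) \<Rightarrow> nat \<Rightarrow> nat" where
  "left_weight x l = (\<Sum>i\<le>l. \<Prod>h = i..<l. x h)"

text \<open>The mirror image \<open>R\<close>: intervals start at \<open>l + 1\<close>, and
  \<open>j = l\<close> contributes the empty one.\<close>

definition right_weight :: "nat \<Rightarrow> (nat \<Rightarrow> nat) \<Rightarrow> nat \<Rightarrow> nat" where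
  "right_weight m x l = (\<Sum>j = l..m. \<Prod>h \<in> {l<..j}. x h)"

lemma left_weight_0: "left_weight x 0 = 1"
  by (simp add: left_weight_def)

lemma left_weight_Suc: "left_weight x (Suc l) = 1 + x l * left_weight x l"
  by (simp add: left_weight_def sum_distrib_left mult.commute)

lemma right_weight_top: "right_weight m x m = 1"
  by (simp add: right_weight_def)

lemma right_weight_step:
  assumes "l < m"
  shows "right_weight m x l = 1 + x (Suc l) * right_weight m x (Suc l)"
proof -
  have "{l<..j} = insert (Suc l) {Suc l<..j}" if "Suc l \<le> j" for j
    using that by auto
  then have "(\<Prod>h \<in> {l<..j}. x h) = x (Suc l) * (\<Prod>h \<in> {Suc l<..j}. x h)" if "Suc l \<le> j" for j
    using that by simp
  then show ?thesis
    using assms by (simp add: right_weight_def sum.atLeast_Suc_atMost sum_distrib_left)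
qed

text \<open>Since \<open>x l \<ge> 1\<close>, the recursion adds at least 1 in each step.\<close>

lemma left_weight_less:
  assumes "\<And>i. 1 \<le> x i" "l < l'"
  shows "left_weight x l < left_weight x l'"
proof -
  have "left_weight x i < left_weight x (Suc i)" for i
    using mult_le_mono1[OF assms(1)[of i], of "left_weight x i"]
    unfolding left_weight_Suc by linarith
  then show ?thesis using assms(2) by (rule lift_Suc_mono_less)
qed

lemma right_weight_less:
  assumes "\<And>i. 1 \<le> x i" "l < l'" "l' \<le> m"
  shows "right_weight m x l' < right_weight m x l"
  using assms(2,3)
proof (induction l' rule: less_Suc_induct)
  case (1 i)
  then have "right_weight m x i = 1 + x (Suc i) * right_weight m x (Suc i)"
    by (simp add: right_weight_step)
  then show ?case
    using mult_le_mono1[OF assms(1)[of "Suc i"], of "right_weight m x (Suc i)"] by linarith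
next
  case (2 i j k)
  then show ?case by simp
qed

text \<open>Only the intervals ending in \<open>l\<close> or starting in \<open>l + 1\<close> change their product.\<close>

lemma interval_weight_transpose:
  assumes "l < m"
  shows "int (interval_weight m (x \<circ> transpose l (Suc l))) - int (interval_weight m x) =
    (int (x (Suc l)) - int (x l)) * (int (left_weight x l) - int (right_weight m x (Suc l)))"
proof -
  let ?\<tau> = "transpose l (Suc l)" and ?c = "int (x (Suc l)) - int (x l)"
  let ?D = "{(i, j). i \<le> j \<and> j \<le> m}"
  \<comment> \<open>Intervals ending in \<open>l\<close> trade the factor \<open>x l\<close> for
    \<open>x (Suc l)\<close>, those starting in \<open>Suc l\<close> do the opposite; hence the
    common \<open>?c\<close> and the opposite signs of \<open>?f\<close> and
    \<open>?g\<close>.\<close>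
  let ?f = "\<lambda>(i, j). if j = l then ?c * (\<Prod>h = i..<l. int (x h)) else 0"
  let ?g = "\<lambda>(i, j). if i = Suc l then ?c * (\<Prod>h \<in> {Suc l<..j}. int (x h)) else 0"
  have diff: "(\<Prod>h = i..j. int (x (?\<tau> h))) - (\<Prod>h = i..j. int (x h)) = ?f (i, j) - ?g (i, j)"
    if "i \<le> j" for i j
  proof -
    consider "j = l" | "i = Suc l" | "j \<noteq> l" "i \<noteq> Suc l" by blast
    then show ?thesis
    proof cases
      case 1
      have "{i..j} = insert l {i..<l}" using 1 that by auto
      moreover have "(\<Prod>h = i..<l. int (x (?\<tau> h))) = (\<Prod>h = i..<l. int (x h))"
        by (intro prod.cong) auto
      ultimately show ?thesis using 1 that by (simp add: algebra_simps)
    next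
      case 2
      have "{i..j} = insert (Suc l) {Suc l<..j}" using 2 that by auto
      moreover have "(\<Prod>h \<in> {Suc l<..j}. int (x (?\<tau> h))) = (\<Prod>h \<in> {Suc l<..j}. int (x h))"
        by (intro prod.cong) auto
      ultimately show ?thesis using 2 that by (simp add: algebra_simps)
    next
      case 3
      \<comment> \<open>Such an interval contains both \<open>l\<close> and \<open>Suc l\<close>,
        whose factors are only permuted, or neither.\<close>
      have "(\<Prod>h = i..j. int (x (?\<tau> h))) = (\<Prod>h = i..j. int (x h))"
      proof (cases "l \<in> {i..j}")
        case True
        then have "?\<tau> permutes {i..j}"
          using 3 by (intro permutes_swap_id) auto
        from prod.permute[OF this, of "\<lambda>h. int (x h)"] show ?thesis by (simp add: comp_def)
      next
        case False
        then show ?thesis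
          using 3 by (intro prod.cong refl) (auto simp: transpose_def)
      qed
      then show ?thesis using 3 by simp
    qed
  qed
  have "int (interval_weight m (x \<circ> ?\<tau>)) - int (interval_weight m x) =
      (\<Sum>p\<in>?D. ?f p - ?g p)"
    unfolding interval_weight_def of_nat_sum sum_subtractf[symmetric]
    by (intro sum.cong refl) (use diff in \<open>force simp: of_nat_prod\<close>)
  also have "\<dots> = sum ?f ?D - sum ?g ?D"
    by (rule sum_subtractf)
  \<comment> \<open>Only the pairs with \<open>j = l\<close> survive, one for each
    \<open>i \<le> l\<close>.\<close>
  also have "sum ?f ?D = sum ?f ((\<lambda>i. (i, l)) ` {..l})"
    using assms finite_intervals by (intro sum.mono_neutral_right) (auto split: if_splits)
  also have "\<dots> = ?c * int (left_weight x l)"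
    by (subst sum.reindex) (auto simp: inj_on_def left_weight_def sum_distrib_left)
  also have "sum ?g ?D = sum ?g ((\<lambda>j. (Suc l, j)) ` {Suc l..m})"
    using assms finite_intervals by (intro sum.mono_neutral_right) (auto split: if_splits)
  also have "\<dots> = ?c * int (right_weight m x (Suc l))"
    by (subst sum.reindex) (auto simp: inj_on_def right_weight_def sum_distrib_left)
  finally show ?thesis by (simp only: right_diff_distrib)
qed

text \<open>Exchanging two inner positions yields a competitor, so the change, a product of two
  factors, is nonnegative. A strict comparison of \<open>z\<close> fixes the sign of the first
  factor and thereby bounds the second.\<close>

lemma minimum_optimal_transpose:
  assumes "minimum_optimal_caterpillar n d (caterpillar (Suc k) z)" "1 \<le> l" "l < k"
  defines "x \<equiv> \<lambda>j. 2 ^ z j"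
  shows "z (Suc l) < z l \<Longrightarrow> left_weight x l \<le> right_weight (Suc k) x (Suc l)"
    and "z l < z (Suc l) \<Longrightarrow> right_weight (Suc k) x (Suc l) \<le> left_weight x l"
proof -
  let ?\<tau> = "transpose l (Suc l)"
  have perm: "?\<tau> permutes {0<..<Suc k}"
    using assms(2,3) by (intro permutes_swap_id) auto
  then have "caterpillar (Suc k) (z \<circ> ?\<tau>) \<in> caterpillars n d"
    using assms(1) has_degree_sequence_caterpillar_permute is_caterpillar_caterpillar
    unfolding minimum_optimal_caterpillar_def caterpillars_def by blast
  then have "\<phi> (caterpillar (Suc k) z) \<le> \<phi> (caterpillar (Suc k) (z \<circ> ?\<tau>))"
    using assms(1) unfolding minimum_optimal_caterpillar_def by blast
  moreover have perm': "?\<tau> permutes {..Suc k}"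
    using perm by (rule permutes_subset) auto
  ultimately have "interval_weight (Suc k) x \<le> interval_weight (Suc k) (x \<circ> ?\<tau>)"
    unfolding num_subtrees_caterpillar_permute[OF perm'] unfolding num_subtrees_caterpillar x_def
    by (simp only: add_le_cancel_left)
  then have *: "0 \<le> (int (x (Suc l)) - int (x l)) *
      (int (left_weight x l) - int (right_weight (Suc k) x (Suc l)))"
    using interval_weight_transpose[of l "Suc k" x] assms(3) by simp
  show "left_weight x l \<le> right_weight (Suc k) x (Suc l)" if "z (Suc l) < z l"
  proof -
    have "int (x (Suc l)) < int (x l)" using that by (simp add: x_def)
    then show ?thesis using * by (auto simp: zero_le_mult_iff)
  qed
  show "right_weight (Suc k) x (Suc l) \<le> left_weight x l" if "z l < z (Suc l)"
  proof -
    have "int (x l) < int (x (Suc l))" using that by (simp add: x_def)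
    then show ?thesis using * by (auto simp: zero_le_mult_iff)
  qed
qed

text \<open>An ascent at \<open>l\<close> needs \<open>R \<le> L\<close> there, a later descent at
  \<open>l'\<close> needs \<open>L \<le> R\<close>; but from \<open>l\<close> to \<open>l'\<close>
  the value of \<open>L\<close> grows and that of \<open>R\<close> falls.\<close>

lemma minimum_optimal_valley:
  assumes "minimum_optimal_caterpillar n d (caterpillar (Suc k) z)"
    and "1 \<le> l" "l < l'" "l' < k" "z l < z (Suc l)"
  shows "z l' \<le> z (Suc l')"
proof (rule ccontr)
  let ?x = "\<lambda>j. 2 ^ z j :: nat"
  assume "\<not> z l' \<le> z (Suc l')"
  then have "left_weight ?x l' \<le> right_weight (Suc k) ?x (Suc l')"
    using minimum_optimal_transpose(1)[OF assms(1), of l'] assms by simp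
  also have "\<dots> < right_weight (Suc k) ?x (Suc l)"
    using assms by (intro right_weight_less) auto
  also have "\<dots> \<le> left_weight ?x l"
    using minimum_optimal_transpose(2)[OF assms(1), of l] assms by simp
  also have "\<dots> < left_weight ?x l'"
    using assms by (intro left_weight_less) auto
  finally show False .
qed

lemma minimum_optimal_last:
  assumes "minimum_optimal_caterpillar n d (caterpillar (Suc k) z)"
    and "3 \<le> k" "z (Suc k) = 0"
  shows "z (k - 1) \<le> z k"
proof (rule ccontr)
  let ?x = "\<lambda>j. 2 ^ z j :: nat"
  assume "\<not> z (k - 1) \<le> z k"
  then have "left_weight ?x (k - 1) \<le> right_weight (Suc k) ?x k"
    using minimum_optimal_transpose(1)[OF assms(1), of "k - 1"] assms by simp
  \<comment> \<open>The end vertex has no pendants, hence weight 1, and the recursion gives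
    \<open>1 + 1 * 1\<close>.\<close>
  also have "\<dots> = 2"
    using assms by (simp add: right_weight_step right_weight_top)
  finally have "left_weight ?x (k - 1) \<le> 2" .
  \<comment> \<open>As \<open>1 < k - 1\<close>, two strict increases from the initial value 1
    exceed 2.\<close>
  moreover have "left_weight ?x 0 < left_weight ?x 1" "left_weight ?x 1 < left_weight ?x (k - 1)"
    using assms by (auto intro!: left_weight_less)
  ultimately show False by (simp add: left_weight_0)
qed

section \<open>Shape of an optimal sequence of pendant numbers\<close>

theorem theorem3p4:
  fixes T :: "'a graph" and n k :: nat and d z :: "nat \<Rightarrow> nat"
  assumes "is_tree T" and "has_degree_sequence T n d"
    and "3 \<le> k" and "k \<le> n"
    and "\<And>i j. 1 \<le> i \<Longrightarrow> i \<le> j \<Longrightarrow> j \<le> k \<Longrightarrow> d j \<le> d i"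
    and "2 \<le> d k"
    and "\<And>i. k < i \<Longrightarrow> i \<le> n \<Longrightarrow> d i = 1"
    and "image_mset z (mset_set {1..k}) = image_mset (\<lambda>i. d i - 2) (mset_set {1..k})"
    and "minimum_optimal_caterpillar n d (C_graph k z)"
    and "z k \<le> z 1"
  shows "\<exists>t. 1 \<le> t \<and> t \<le> k - 1 \<and>
           (\<forall>i. 1 \<le> i \<and> i + 1 \<le> t - 1 \<longrightarrow> z i \<ge> z (i + 1)) \<and>
           (1 < t \<longrightarrow> z (t - 1) > z t) \<and>
           z t = d k - 2 \<and>
           (\<forall>i. t \<le> i \<and> i < k \<longrightarrow> z i \<le> z (i + 1))"
proof -
  define w where "w = (\<lambda>j. if 1 \<le> j \<and> j \<le> k then z j else 0)"
  have opt: "minimum_optimal_caterpillar n d (caterpillar (Suc k) w)"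
    using assms(9) by (simp add: C_graph_eq_caterpillar w_def)
  have wz: "w j = z j" if "1 \<le> j" "j \<le> k" for j
    using that by (simp add: w_def)
  have valley: "z l' \<le> z (Suc l')" if "1 \<le> l" "l < l'" "l' < k" "z l < z (Suc l)" for l l'
    using minimum_optimal_valley[OF opt that(1-3)] that wz by simp
  have last: "z (k - 1) \<le> z k"
    using minimum_optimal_last[OF opt assms(3)] assms(3) wz[of "k - 1"] wz[of k]
    by (simp add: w_def[THEN fun_cong, of "Suc k"])
  \<comment> \<open>Since \<open>d\<close> is nonincreasing on \<open>{1..k}\<close>,
    \<open>d k - 2\<close> is the minimum of \<open>z\<close> there.\<close>
  have "z ` {1..k} = (\<lambda>i. d i - 2) ` {1..k}"
    using arg_cong[OF assms(8), of set_mset] by simp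
  then have ex: "\<exists>t. t \<in> {1..k} \<and> z t = d k - 2"
    and min: "\<And>j. j \<in> {1..k} \<Longrightarrow> d k - 2 \<le> z j"
  proof -
    assume eq: "z ` {1..k} = (\<lambda>i. d i - 2) ` {1..k}"
    have "d k - 2 \<in> z ` {1..k}" unfolding eq using assms(3) by simp
    then show "\<exists>t. t \<in> {1..k} \<and> z t = d k - 2" by (metis imageE)
    fix j assume "j \<in> {1..k}"
    then have "z j \<in> (\<lambda>i. d i - 2) ` {1..k}" using eq by blast
    then obtain i where "i \<in> {1..k}" "z j = d i - 2" by blast
    then show "d k - 2 \<le> z j" using assms(5)[of i k] by simp
  qed
  \<comment> \<open>Taking the first position of the minimum makes all earlier values strictly
    larger.\<close>
  define t where "t = (LEAST t. t \<in> {1..k} \<and> z t = d k - 2)"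
  have t: "t \<in> {1..k}" "z t = d k - 2"
    using LeastI_ex[OF ex] by (auto simp: t_def)
  have least: "d k - 2 < z j" if "1 \<le> j" "j < t" for j
  proof -
    have "z j \<noteq> d k - 2"
      using not_less_Least[of j "\<lambda>t. t \<in> {1..k} \<and> z t = d k - 2"] that t by (auto simp: t_def)
    then show ?thesis using min[of j] that t by auto
  qed
  \<comment> \<open>Otherwise \<open>z (k - 1)\<close> would exceed the minimum \<open>z k\<close>,
    against \<open>last\<close>.\<close>
  have "t \<noteq> k"
    using least[of "k - 1"] last t assms(3) by fastforce
  have incr: "z a \<le> z b" if "a \<le> b" "\<And>i. a \<le> i \<Longrightarrow> i < b \<Longrightarrow> z i \<le> z (Suc i)" for a b
    using that(1) by (induction b rule: dec_induct) (use that(2) in \<open>auto intro: order_trans\<close>)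
  have decr: "z b \<le> z a" if "a \<le> b" "\<And>i. a \<le> i \<Longrightarrow> i < b \<Longrightarrow> z (Suc i) \<le> z i" for a b
    using that(1) by (induction b rule: dec_induct) (use that(2) in \<open>auto intro: order_trans\<close>)
  show ?thesis
  proof (intro exI[of _ t] conjI allI impI)
    show "1 \<le> t" "t \<le> k - 1" "z t = d k - 2"
      using t \<open>t \<noteq> k\<close> by auto
    show "z t < z (t - 1)" if "1 < t"
      using least[of "t - 1"] that t by simp
    \<comment> \<open>After an ascent at \<open>i\<close>, \<open>valley\<close> forbids descents up
      to \<open>t\<close>, so \<open>z t\<close> would exceed \<open>z i\<close>.\<close>
    show "z (i + 1) \<le> z i" if "1 \<le> i \<and> i + 1 \<le> t - 1" for i
    proof (rule ccontr)
      assume "\<not> z (i + 1) \<le> z i"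
      then have up: "z i < z (Suc i)" by simp
      have "z (Suc i) \<le> z t"
      proof (rule incr)
        show "z h \<le> z (Suc h)" if "Suc i \<le> h" "h < t" for h
          using valley[of i h] up that t \<open>1 \<le> i \<and> i + 1 \<le> t - 1\<close> by simp
      qed (use that in linarith)
      moreover have "z t < z i" using least[of i] that t by linarith
      ultimately show False using up by simp
    qed
    \<comment> \<open>Before a descent at \<open>i\<close>, \<open>valley\<close> forbids ascents
      from \<open>t\<close> on, so \<open>z i\<close> would be at most the minimum
      \<open>z t\<close>, and \<open>z (i + 1)\<close> would lie below it.\<close>
    show "z i \<le> z (i + 1)" if "t \<le> i \<and> i < k" for i
    proof (rule ccontr)
      assume neg: "\<not> z i \<le> z (i + 1)"
      have "z i \<le> z t"
      proof (rule decr)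
        fix l assume l: "t \<le> l" "l < i"
        show "z (Suc l) \<le> z l"
        proof (rule ccontr)
          assume "\<not> z (Suc l) \<le> z l"
          then have "z i \<le> z (Suc i)"
            using valley[of l i] l that t by simp
          then show False using neg by simp
        qed
      qed (use that in simp)
      moreover have "z t \<le> z (i + 1)"
        using min[of "i + 1"] that t by simp
      ultimately show False using neg by simp
    qed
  qed
qed

end
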